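(* Let $G$ be a finite connected bridgeless planar graph, embedded in the plane, and let $C_1$ and $C_2$ be two cycles in $G$ with the same signature. Then $C_1$ and $C_2$ have the same length (number of edges).
   Context: For a planar graph $G$ embedded in the plane and a cycle $C$ in $G$, the signature of $C$ in $G$ is the function assigning to each finite (i.e. bounded) face $F$ of $G$ the number of edges of $F$ (edges on the boundary of $F$) which belong to $C$. The exterior (unbounded) face receives no number. *)

theory Defs
  imports "HOL-Analysis.Analysis"
begin

text \<open>Undirected graphs; parallel edges and loops are allowed. The set \<open>ends G e\<close> of end vertices of
  an edge has two elements, or one if \<open>e\<close> is a loop. A simple graph is the case where
  \<open>ends G\<close> is injective on the edges and takes only two-element values.\<close>

record ('v, 'e) ugraph =
  verts :: "'v set"
  edges :: "'e set"
  ends :: "'e \<Rightarrow> 'v set"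

definition finite_graph :: "('v, 'e) ugraph \<Rightarrow> bool" where
  "finite_graph G \<longleftrightarrow> finite (verts G) \<and> finite (edges G) \<and>
     (\<forall>e\<in>edges G. \<exists>u\<in>verts G. \<exists>v\<in>verts G. ends G e = {u, v})"

definition adjacency :: "('v, 'e) ugraph \<Rightarrow> ('v \<times> 'v) set" where
  "adjacency G = {(u, v). \<exists>e\<in>edges G. ends G e = {u, v}}"

definition connected_graph :: "('v, 'e) ugraph \<Rightarrow> bool" where
  "connected_graph G \<longleftrightarrow> verts G \<noteq> {} \<and> (\<forall>u\<in>verts G. \<forall>v\<in>verts G. (u, v) \<in> (adjacency G)\<^sup>*)"

definition delete_edge :: "('v, 'e) ugraph \<Rightarrow> 'e \<Rightarrow> ('v, 'e) ugraph" where
  "delete_edge G e = G\<lparr>edges := edges G - {e}\<rparr>"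

definition bridge :: "('v, 'e) ugraph \<Rightarrow> 'e \<Rightarrow> bool" where
  "bridge G e \<longleftrightarrow> e \<in> edges G \<and>
     (\<exists>u\<in>verts G. \<exists>v\<in>verts G. (u, v) \<in> (adjacency G)\<^sup>* \<and> (u, v) \<notin> (adjacency (delete_edge G e))\<^sup>*)"

definition bridgeless :: "('v, 'e) ugraph \<Rightarrow> bool" where
  "bridgeless G \<longleftrightarrow> (\<forall>e. \<not> bridge G e)"

text \<open>A cycle is represented by its set of edges, so its length is the cardinality of that set.
  Length 1 is a loop and length 2 a pair of parallel edges; neither occurs in a simple graph.\<close>

definition is_cycle :: "('v, 'e) ugraph \<Rightarrow> 'e set \<Rightarrow> bool" where
  "is_cycle G C \<longleftrightarrow> (\<exists>vs es. es \<noteq> [] \<and> length vs = length es \<and> distinct vs \<and> distinct es \<and>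
     set vs \<subseteq> verts G \<and> set es \<subseteq> edges G \<and> C = set es \<and>
     (\<forall>i<length es. ends G (es ! i) = {vs ! i, vs ! (Suc i mod length es)}))"

text \<open>Vertices are drawn as distinct points and edges as simple curves joining their ends: arcs, or
  simple closed curves for loops (the condition on end points forces the curve to be closed exactly
  for loops). A curve meets vertices only at its end points, and two curves meet only at vertices.\<close>

definition plane_embedding ::
  "('v, 'e) ugraph \<Rightarrow> ('v \<Rightarrow> complex) \<Rightarrow> ('e \<Rightarrow> real \<Rightarrow> complex) \<Rightarrow> bool" where
  "plane_embedding G pos curve \<longleftrightarrow>
     inj_on pos (verts G) \<and>
     (\<forall>e\<in>edges G. simple_path (curve e) \<and>
        {pathstart (curve e), pathfinish (curve e)} = pos ` ends G e \<and>
        path_image (curve e) \<inter> pos ` verts G = pos ` ends G e) \<and>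
     (\<forall>e\<in>edges G. \<forall>f\<in>edges G. e \<noteq> f \<longrightarrow>
        path_image (curve e) \<inter> path_image (curve f) \<subseteq> pos ` verts G)"

definition drawing ::
  "('v, 'e) ugraph \<Rightarrow> ('v \<Rightarrow> complex) \<Rightarrow> ('e \<Rightarrow> real \<Rightarrow> complex) \<Rightarrow> complex set" where
  "drawing G pos curve = pos ` verts G \<union> (\<Union>e\<in>edges G. path_image (curve e))"

definition faces ::
  "('v, 'e) ugraph \<Rightarrow> ('v \<Rightarrow> complex) \<Rightarrow> ('e \<Rightarrow> real \<Rightarrow> complex) \<Rightarrow> complex set set" where
  "faces G pos curve = components (- drawing G pos curve)"

definition finite_faces ::
  "('v, 'e) ugraph \<Rightarrow> ('v \<Rightarrow> complex) \<Rightarrow> ('e \<Rightarrow> real \<Rightarrow> complex) \<Rightarrow> complex set set" where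
  "finite_faces G pos curve = {F \<in> faces G pos curve. bounded F}"

definition face_edges :: "('v, 'e) ugraph \<Rightarrow> ('e \<Rightarrow> real \<Rightarrow> complex) \<Rightarrow> complex set \<Rightarrow> 'e set" where
  "face_edges G curve F = {e \<in> edges G. path_image (curve e) \<subseteq> frontier F}"

text \<open>The signature is a function with domain \<open>finite_faces\<close>; by \<open>restrict\<close> it is
  \<open>undefined\<close> elsewhere, so equality of signatures means agreement on all finite faces.\<close>

definition signature ::
  "('v, 'e) ugraph \<Rightarrow> ('v \<Rightarrow> complex) \<Rightarrow> ('e \<Rightarrow> real \<Rightarrow> complex) \<Rightarrow> 'e set \<Rightarrow> complex set \<Rightarrow> nat" where
  "signature G pos curve C =
     (\<lambda>F\<in>finite_faces G pos curve. card (face_edges G curve F \<inter> C))"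

end

theory Submission
  imports Defs
begin

text \<open>For a cycle \<open>C\<close> let the side of a face be \<open>1\<close> if it is inside the Jordan curve of \<open>C\<close> and \<open>-1\<close>
  otherwise. Every edge of a bridgeless plane graph lies on exactly two faces, and they are on
  different sides of \<open>C\<close> exactly for the edges of \<open>C\<close>. Let \<open>t\<close> be the product of the side functions
  of the two cycles. If an edge lies on only one of the cycles, the values of \<open>t\<close> on its two faces
  cancel. Hence, if \<open>d F\<close> is the difference of the numbers of edges that the cycles have on the
  face \<open>F\<close>, the sum of \<open>t F * d F\<close> over all faces is zero. All bounded faces contribute zero, so the
  unbounded face does too; as \<open>t = 1\<close> there, \<open>d\<close> vanishes everywhere. Counting edges over all faces
  counts every edge of a cycle twice.\<close>

section \<open>Faces along an arc of a closed curve\<close>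

text \<open>Points of \<open>U\<close> near \<open>A\<close> are joined both in the complement of \<open>D - A\<close> and in the complement of
  \<open>J\<close>. As \<open>(D - A) \<inter> J = J - A\<close> is connected, they are joined in the complement of \<open>D\<close> by
  Janiszewski's theorem.\<close>

lemma ex1_component_along_arc:
  fixes D A J U :: "complex set"
  assumes D: "compact D" and S: "compact (D - A)" and A: "connected A" "A \<noteq> {}" "A \<subseteq> J"
    and J: "J \<subseteq> D" "closed J" "connected (J - A)"
    and U: "connected U" "U \<inter> J = {}" "frontier U = J"
  shows "\<exists>!F. F \<in> components (- D) \<and> F \<subseteq> U \<and> A \<subseteq> closure F"
proof -
  obtain p0 where p0: "p0 \<in> A" using A by blast
  \<comment> \<open>\<open>K\<close> is an open connected neighbourhood of \<open>A\<close> that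
    misses the rest of \<open>D\<close>; being near \<open>A\<close> means lying in
    \<open>K\<close>.\<close>
  define K where "K = connected_component_set (- (D - A)) p0"
  have AK: "A \<subseteq> K"
    unfolding K_def using A p0 by (intro connected_component_maximal) auto
  have opK: "open K"
    unfolding K_def using S by (intro open_connected_component open_Compl compact_imp_closed)
  have KS: "K \<subseteq> - (D - A)"
    unfolding K_def by (rule connected_component_subset)
  have KU: "x \<notin> D" if "x \<in> U" "x \<in> K" for x
    using that KS U(2) A(3) by auto
  have "connected K"
    by (simp add: K_def)
  have same: "connected_component (- D) x y" if "x \<in> U" "y \<in> U" "x \<in> K" "y \<in> K" for x y
  proof -
    have DJ: "(D - A) \<union> J = D" "(D - A) \<inter> J = J - A"
      using A(3) J(1) by auto
    have "connected_component (- ((D - A) \<union> J)) x y"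
    proof (rule Janiszewski[OF S J(2)])
      show "connected ((D - A) \<inter> J)"
        using J(3) DJ by simp
      show "connected_component (- (D - A)) x y"
        unfolding connected_component_def using KS \<open>connected K\<close> that by blast
      show "connected_component (- J) x y"
        unfolding connected_component_def using U that by blast
    qed
    then show ?thesis
      using DJ by simp
  qed
  have meet: "V \<inter> U \<noteq> {}" if "open V" "p \<in> A" "p \<in> V" for V p
    using that A(3) U(3) by (metis Int_commute frontier_straddle open_Int_closure_eq_empty
        Diff_iff disjoint_iff frontier_def subsetD)
  obtain x where x: "x \<in> U" "x \<in> K"
    using meet[OF opK p0] AK p0 by blast
  define F where "F = connected_component_set (- D) x"
  have xF: "x \<in> F"
    using KU[OF x] by (simp add: F_def)
  have F: "F \<in> components (- D)"
    using KU[OF x] by (auto simp: F_def components_def)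
  have "F \<subseteq> - D"
    using F in_components_subset by blast
  \<comment> \<open>On leaving \<open>U\<close>, the connected set \<open>F\<close> would hit its
    frontier \<open>J\<close>, which lies in \<open>D\<close>.\<close>
  have "F \<subseteq> U"
  proof (rule ccontr)
    assume "\<not> F \<subseteq> U"
    then have "F \<inter> frontier U \<noteq> {}"
      using connected_Int_frontier[of F U] xF x F in_components_connected by blast
    then show False
      using U(3) J(1) \<open>F \<subseteq> - D\<close> by blast
  qed
  moreover have "A \<subseteq> closure F"
  proof
    fix p assume p: "p \<in> A"
    show "p \<in> closure F"
    proof (subst closure_iff_nhds_not_empty, intro allI impI)
      fix B V assume "V \<subseteq> B" "open V" "p \<in> V"
      then have "(V \<inter> K) \<inter> U \<noteq> {}"
        using AK p opK by (intro meet[where p = p]) auto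
      then obtain y where "y \<in> V" "y \<in> K" "y \<in> U" by blast
      then have "y \<in> F"
        using same[OF x(1) _ x(2)] by (simp add: F_def)
      then show "F \<inter> B \<noteq> {}"
        using \<open>y \<in> V\<close> \<open>V \<subseteq> B\<close> by blast
    qed
  qed
  \<comment> \<open>As \<open>A\<close> is nonempty and \<open>K\<close> is a neighbourhood of it,
    any rival \<open>F'\<close> has a point in both \<open>K\<close> and \<open>U\<close>, where all
    points are joined off \<open>D\<close>.\<close>
  moreover have "F' = F" if F': "F' \<in> components (- D)" "F' \<subseteq> U" "A \<subseteq> closure F'" for F'
  proof -
    have "F' \<inter> K \<noteq> {}"
      using F'(3) p0 AK opK by (metis Int_commute disjoint_iff open_Int_closure_eq_empty subsetD)
    then obtain y where y: "y \<in> F'" "y \<in> K" by blast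
    then have "y \<in> F"
      using same[OF x(1) _ x(2)] F'(2) by (auto simp: F_def)
    then show ?thesis
      using components_nonoverlap[OF F'(1) F] y by blast
  qed
  ultimately show ?thesis
    using F by blast
qed

section \<open>Paths and cycles in graphs\<close>

text \<open>Distinct vertices force distinct edges, since different consecutive pairs are different
  sets.\<close>

definition graph_path :: "('v, 'e) ugraph \<Rightarrow> 'v list \<Rightarrow> 'e list \<Rightarrow> bool" where
  "graph_path G us es \<longleftrightarrow> length us = Suc (length es) \<and> distinct us \<and>
     set us \<subseteq> verts G \<and> set es \<subseteq> edges G \<and>
     (\<forall>i<length es. ends G (es ! i) = {us ! i, us ! Suc i})"

text \<open>If \<open>e\<close> is a loop, the path that it closes is a single vertex.\<close>

definition closes :: "('v, 'e) ugraph \<Rightarrow> 'e \<Rightarrow> 'v list \<Rightarrow> 'e list \<Rightarrow> bool" where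
  "closes G e us es \<longleftrightarrow> graph_path G us es \<and> e \<in> edges G - set es \<and> ends G e = {hd us, last us}"

lemma graph_path_Cons:
  "graph_path G (u # us) (e # es) \<longleftrightarrow>
     graph_path G us es \<and> u \<in> verts G - set us \<and> e \<in> edges G \<and> ends G e = {u, hd us}"
  unfolding graph_path_def
  by (cases us) (auto simp: All_less_Suc2)

lemma graph_path_Nil: "graph_path G us [] \<longleftrightarrow> (\<exists>u\<in>verts G. us = [u])"
  unfolding graph_path_def by (auto simp: length_Suc_conv)

lemma graph_path_ends:
  assumes "graph_path G us es" "f \<in> set es"
  shows "ends G f \<subseteq> set us"
proof -
  obtain i where "i < length es" "f = es ! i"
    using assms(2) by (auto simp: in_set_conv_nth)
  then show ?thesis
    using assms(1) by (simp add: graph_path_def)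
qed

text \<open>This cuts off the detour when a walk returns to a vertex of the path built so
  far.\<close>

lemma graph_path_suffix:
  assumes "graph_path G us es" "v \<in> set us"
  shows "\<exists>us' es'. graph_path G us' es' \<and> hd us' = v \<and> last us' = last us \<and> set es' \<subseteq> set es"
  using assms
proof (induction es arbitrary: us)
  case Nil
  then show ?case
    by (intro exI[of _ us] exI[of _ "[]"]) (auto simp: graph_path_Nil)
next
  case (Cons e es)
  then obtain u us1 where us: "us = u # us1"
    by (cases us) (auto simp: graph_path_def)
  then have p: "graph_path G us1 es"
    using Cons.prems by (simp add: graph_path_Cons)
  then have "us1 \<noteq> []"
    by (auto simp: graph_path_def)
  show ?case
  proof (cases "v = u")
    case True
    then show ?thesis
      using Cons.prems us by (intro exI[of _ us] exI[of _ "e # es"]) auto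
  next
    case False
    then show ?thesis
      using Cons.IH[OF p] Cons.prems us \<open>us1 \<noteq> []\<close> by fastforce
  qed
qed

text \<open>The walk is read from its end. Each earlier vertex is prepended to the path, unless it
  already lies there; then the path is cut to start at it.\<close>

lemma rtrancl_adjacency_graph_path:
  assumes "(u, v) \<in> (adjacency G)\<^sup>*" "v \<in> verts G"
    and wf: "\<And>e. e \<in> edges G \<Longrightarrow> ends G e \<subseteq> verts G"
  shows "\<exists>us es. graph_path G us es \<and> hd us = u \<and> last us = v"
  using assms(1)
proof (induction rule: converse_rtrancl_induct)
  case base
  then show ?case
    using assms(2) by (intro exI[of _ "[v]"] exI[of _ "[]"]) (simp add: graph_path_Nil)
next
  case (step y z)
  then obtain us es where p: "graph_path G us es" "hd us = z" "last us = v"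
    by blast
  obtain e where e: "e \<in> edges G" "ends G e = {y, z}"
    using step by (auto simp: adjacency_def)
  show ?case
  proof (cases "y \<in> set us")
    case True
    then show ?thesis
      using graph_path_suffix[OF p(1) True] p by blast
  next
    case False
    then have "graph_path G (y # us) (e # es)"
      using p e wf[OF e(1)] by (auto simp: graph_path_Cons)
    moreover have "us \<noteq> []"
      using p by (auto simp: graph_path_def)
    ultimately show ?thesis
      using p by (intro exI[of _ "y # us"] exI[of _ "e # es"]) auto
  qed
qed

text \<open>The ends of \<open>e\<close> are joined by \<open>e\<close> itself, so, \<open>e\<close>
  being no bridge, they stay joined after its deletion. A path found there avoids
  \<open>e\<close>.\<close>

lemma closes_if_not_bridge:
  assumes G: "finite_graph G" and e: "e \<in> edges G" "\<not> bridge G e"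
  shows "\<exists>us es. closes G e us es"
proof -
  obtain u v where uv: "u \<in> verts G" "v \<in> verts G" "ends G e = {u, v}"
    using G e by (auto simp: finite_graph_def)
  have "(u, v) \<in> (adjacency G)\<^sup>*"
    using uv e by (auto simp: adjacency_def)
  then have "(u, v) \<in> (adjacency (delete_edge G e))\<^sup>*"
    using e uv by (auto simp: bridge_def)
  moreover have "ends (delete_edge G e) f \<subseteq> verts (delete_edge G e)" if "f \<in> edges (delete_edge G e)" for f
    using that G by (fastforce simp: finite_graph_def delete_edge_def)
  ultimately obtain us es where p: "graph_path (delete_edge G e) us es" "hd us = u" "last us = v"
    using rtrancl_adjacency_graph_path[of u v "delete_edge G e"] uv by (auto simp: delete_edge_def)
  then have "closes G e us es"
    using uv e by (auto simp: closes_def graph_path_def delete_edge_def)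
  then show ?thesis by blast
qed

lemma closes_if_in_cycle:
  assumes "is_cycle G C" "e \<in> C"
  shows "\<exists>us es. closes G e us es \<and> C = insert e (set es)"
proof -
  obtain vs es where c: "es \<noteq> []" "length vs = length es" "distinct vs" "distinct es"
    "set vs \<subseteq> verts G" "set es \<subseteq> edges G" "C = set es"
    "\<And>i. i < length es \<Longrightarrow> ends G (es ! i) = {vs ! i, vs ! (Suc i mod length es)}"
    using assms(1) unfolding is_cycle_def by blast
  obtain i where i: "i < length es" "es ! i = e"
    using assms(2) c(7) by (auto simp: in_set_conv_nth)
  define n where "n = length es"
  \<comment> \<open>Rotation by \<open>Suc i\<close> makes \<open>e\<close> the last edge and the
    vertex following it the first vertex; dropping \<open>e\<close> opens the cycle to a path. For a
    loop no edge remains.\<close>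
  define us where "us = rotate (Suc i) vs"
  define es1 where "es1 = rotate (Suc i) es"
  define es' where "es' = butlast es1"
  have n: "n > 0" "length us = n" "length es1 = n" "length es' = n - 1" "i < n"
    using c i by (auto simp: n_def us_def es1_def es'_def)
  then have ne: "us \<noteq> []" "es1 \<noteq> []" by auto
  have i_n: "(Suc i + (n - 1)) mod n = i"
    using n by simp
  have us_nth: "us ! k = vs ! ((Suc i + k) mod n)" if "k < n" for k
    using that c by (simp add: us_def n_def nth_rotate del: rotate_Suc)
  have es1_nth: "es1 ! k = es ! ((Suc i + k) mod n)" if "k < n" for k
    using that c by (simp add: es1_def n_def nth_rotate del: rotate_Suc)
  have "last es1 = e"
    using es1_nth[of "n - 1"] n i_n i ne by (simp add: last_conv_nth)
  then have es1: "es1 = es' @ [e]"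
    using ne by (metis append_butlast_last_id es'_def)
  have dist: "distinct es1" "set es1 = C" "distinct us" "set us = set vs"
    using c by (auto simp: es1_def us_def simp del: rotate_Suc)
  have "graph_path G us es'"
    unfolding graph_path_def
  proof (intro conjI allI impI)
    fix k assume "k < length es'"
    then have k: "k < n" "Suc k < n" "k < length es'" using n by auto
    have "es' ! k = es ! ((Suc i + k) mod n)"
      using es1_nth[OF k(1)] es1 k(3) by (simp add: nth_append)
    moreover have "us ! Suc k = vs ! (Suc ((Suc i + k) mod n) mod n)"
      using us_nth[OF k(2)] by (simp add: mod_Suc_eq)
    ultimately show "ends G (es' ! k) = {us ! k, us ! Suc k}"
      using c(8)[of "(Suc i + k) mod n"] us_nth[OF k(1)] n by (simp add: n_def)
  qed (use n dist c es1 in auto)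
  moreover have "ends G e = {hd us, last us}"
  proof -
    have "hd us = vs ! (Suc i mod n)"
      using us_nth[of 0] n ne by (simp add: hd_conv_nth)
    moreover have "last us = vs ! i"
      using us_nth[of "n - 1"] n i_n ne by (simp add: last_conv_nth)
    ultimately show ?thesis
      using c(8)[OF i(1)] i(2) by (auto simp: n_def)
  qed
  moreover have "C = insert e (set es')" "e \<notin> set es'"
    using dist es1 by auto
  ultimately show ?thesis
    using assms c by (auto simp: closes_def intro!: exI[of _ us] exI[of _ es'])
qed

section \<open>Plane graphs\<close>

locale plane_graph =
  fixes G :: "('v, 'e) ugraph" and pos :: "'v \<Rightarrow> complex" and curve :: "'e \<Rightarrow> real \<Rightarrow> complex"
  assumes fin: "finite_graph G" and emb: "plane_embedding G pos curve"
begin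

section \<open>Edges as point sets\<close>

abbreviation "img e \<equiv> path_image (curve e)"
abbreviation "Img C \<equiv> \<Union>e\<in>C. img e"
abbreviation "D \<equiv> drawing G pos curve"
text \<open>The open edge: it avoids all vertices and all other edges, so it can be taken out of the
  drawing without disturbing the rest. A loop loses just one point.\<close>

definition "core e = img e - pos ` ends G e"

lemma ends_subset: "e \<in> edges G \<Longrightarrow> ends G e \<subseteq> verts G"
  using fin by (fastforce simp: finite_graph_def)

lemma simple_curve: "e \<in> edges G \<Longrightarrow> simple_path (curve e)"
  and curve_ends: "e \<in> edges G \<Longrightarrow> {pathstart (curve e), pathfinish (curve e)} = pos ` ends G e"
  and img_verts: "e \<in> edges G \<Longrightarrow> img e \<inter> pos ` verts G = pos ` ends G e"
  and img_img: "e \<in> edges G \<Longrightarrow> f \<in> edges G \<Longrightarrow> e \<noteq> f \<Longrightarrow> img e \<inter> img f \<subseteq> pos ` verts G"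
  and inj_pos: "inj_on pos (verts G)"
  using emb by (auto simp: plane_embedding_def)

lemma finite_edges: "finite (edges G)"
  using fin by (auto simp: finite_graph_def)

lemma compact_img: "e \<in> edges G \<Longrightarrow> compact (img e)"
  using simple_curve by (simp add: compact_simple_path_image)

lemma compact_Img: "C \<subseteq> edges G \<Longrightarrow> compact (Img C)"
  using finite_edges finite_subset compact_img by (intro compact_UN) blast+

lemma compact_drawing: "compact D"
  using fin compact_Img[of "edges G"] unfolding drawing_def
  by (intro compact_Un[OF finite_imp_compact]) (auto simp: finite_graph_def)

lemma core_eq: "e \<in> edges G \<Longrightarrow> core e = img e - {pathstart (curve e), pathfinish (curve e)}"
  by (simp add: core_def curve_ends)

lemma core_Int_img:
  assumes "e \<in> edges G" "f \<in> edges G" "e \<noteq> f"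
  shows "core e \<inter> img f = {}"
  using img_img[OF assms] img_verts[OF assms(1)] by (auto simp: core_def)

lemma core_verts: "e \<in> edges G \<Longrightarrow> core e \<inter> pos ` verts G = {}"
  using img_verts[of e] by (auto simp: core_def)

lemma connected_core: "e \<in> edges G \<Longrightarrow> connected (core e)"
  using connected_simple_path_endless[of "curve e"] simple_curve[of e] by (simp add: core_eq)

lemma core_nonempty: "e \<in> edges G \<Longrightarrow> core e \<noteq> {}"
  using nonempty_simple_path_endless[of "curve e"] simple_curve[of e] by (metis core_eq)

text \<open>The open unit interval is dense in the closed one, and continuity carries this over.
  Hence a closed set that contains the core contains the whole edge.\<close>

lemma img_subset_closure_core:
  assumes "e \<in> edges G"
  shows "img e \<subseteq> closure (core e)"
proof -
  have "continuous_on {0..1} (curve e)"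
    using simple_curve[OF assms] by (simp add: simple_path_def path_def)
  moreover have "core e = curve e ` {0<..<1}"
    using simple_path_endless[of "curve e"] simple_curve assms by (simp add: core_eq)
  ultimately have "curve e ` closure {0<..<1::real} \<subseteq> closure (core e)"
    by (intro image_closure_subset) (auto intro: closure_subset[THEN subsetD])
  then show ?thesis
    by (simp add: path_image_def)
qed

lemma img_subset_drawing: "e \<in> edges G \<Longrightarrow> img e \<subseteq> D"
  by (auto simp: drawing_def)

text \<open>What remains is exactly the vertices and the other edges, a finite union of compact
  sets.\<close>

lemma compact_drawing_minus_core:
  assumes "e \<in> edges G"
  shows "compact (D - core e)"
proof -
  have "D - core e = pos ` verts G \<union> Img (edges G - {e})"
  proof
    show "D - core e \<subseteq> pos ` verts G \<union> Img (edges G - {e})"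
      using ends_subset[OF assms] by (auto simp: drawing_def core_def)
    show "pos ` verts G \<union> Img (edges G - {e}) \<subseteq> D - core e"
      using core_Int_img[OF assms] core_verts[OF assms] by (fastforce simp: drawing_def)
  qed
  then show ?thesis
    using fin compact_Img[of "edges G - {e}"]
    by (simp only:) (intro compact_Un[OF finite_imp_compact], auto simp: finite_graph_def)
qed

section \<open>Jordan curves of graph cycles\<close>

lemma oriented_curve:
  assumes "e \<in> edges G" "ends G e = {u, v}" "u \<noteq> v"
  obtains c where "arc c" "path_image c = img e" "pathstart c = pos u" "pathfinish c = pos v"
proof -
  have uv: "{pathstart (curve e), pathfinish (curve e)} = {pos u, pos v}"
    using curve_ends[OF assms(1)] assms(2) by simp
  have "pos u \<noteq> pos v"
    using inj_pos ends_subset[OF assms(1)] assms by (auto dest: inj_onD)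
  \<comment> \<open>An embedding does not fix the direction of \<open>curve e\<close>; in the second
    case the curve is reversed.\<close>
  with uv consider "pathstart (curve e) = pos u" "pathfinish (curve e) = pos v"
    | "pathstart (curve e) = pos v" "pathfinish (curve e) = pos u"
    by (auto simp: doubleton_eq_iff)
  then show ?thesis
  proof cases
    case 1
    then show ?thesis
      using that[of "curve e"] simple_curve[OF assms(1)] \<open>pos u \<noteq> pos v\<close>
      by (auto simp: arc_simple_path)
  next
    case 2
    then show ?thesis
      using that[of "reversepath (curve e)"] simple_curve[OF assms(1)] \<open>pos u \<noteq> pos v\<close>
      by (auto simp: arc_simple_path simple_path_reversepath)
  qed
qed

lemma img_Int_img_subset:
  assumes "e \<in> edges G" "f \<in> edges G" "e \<noteq> f"
  shows "img e \<inter> img f \<subseteq> pos ` (ends G e \<inter> ends G f)"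
proof -
  have "img e \<inter> img f \<subseteq> pos ` ends G e \<inter> pos ` ends G f"
    using img_img[OF assms] img_verts assms by blast
  also have "\<dots> = pos ` (ends G e \<inter> ends G f)"
    using inj_on_image_Int[OF inj_pos] ends_subset assms by metis
  finally show ?thesis .
qed

lemma graph_path_arc:
  assumes "graph_path G us es" "es \<noteq> []"
  shows "\<exists>g. arc g \<and> pathstart g = pos (hd us) \<and> pathfinish g = pos (last us) \<and>
           path_image g = Img (set es)"
  using assms
proof (induction es arbitrary: us)
  case (Cons e es)
  then obtain u us1 where us: "us = u # us1"
    by (cases us) (auto simp: graph_path_def)
  have p: "graph_path G us1 es" "u \<in> verts G" "u \<notin> set us1" "e \<in> edges G" "ends G e = {u, hd us1}"
    using Cons.prems us by (auto simp: graph_path_Cons)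
  then have ne: "us1 \<noteq> []"
    by (auto simp: graph_path_def)
  then have "u \<noteq> hd us1"
    using p by auto
  then obtain c where c: "arc c" "path_image c = img e" "pathstart c = pos u" "pathfinish c = pos (hd us1)"
    using oriented_curve p by metis
  show ?case
  proof (cases "es = []")
    case True
    then show ?thesis
      using c us p by (auto simp: graph_path_Nil)
  next
    case False
    then obtain g where g: "arc g" "pathstart g = pos (hd us1)" "pathfinish g = pos (last us1)"
      "path_image g = Img (set es)"
      using Cons.IH[OF p(1)] by blast
    \<comment> \<open>The vertex \<open>u\<close> is an end of no later edge, so \<open>e\<close>
      can meet the rest only at \<open>hd us1\<close>.\<close>
    have "path_image c \<inter> path_image g \<subseteq> {pathstart g}"
    proof -
      have "img e \<inter> img f \<subseteq> {pos (hd us1)}" if f: "f \<in> set es" for f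
      proof -
        have "u \<notin> ends G f"
          using graph_path_ends[OF p(1) f] p(3) by blast
        moreover have "f \<in> edges G"
          using p(1) f by (auto simp: graph_path_def)
        ultimately show ?thesis
          using img_Int_img_subset[of e f] p(4,5) by auto
      qed
      then show ?thesis
        unfolding c g by (simp only: Int_UN_distrib UN_subset_iff) blast
    qed
    then have "arc (c +++ g)"
      using c g by (intro arc_join) auto
    then show ?thesis
      using c g us ne by (intro exI[of _ "c +++ g"]) (auto simp: path_image_join)
  qed
qed simp

text \<open>A loop is a closed curve already; otherwise the arcs of \<open>e\<close> and of the path
  share only their ends. Removing the core of \<open>e\<close> leaves a point or the arc of the
  path, which is the connectedness that \<open>ex1_component_along_arc\<close> asks for.\<close>

lemma closes_Jordan_curve:
  assumes "closes G e us es" and C: "C = insert e (set es)"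
  shows "\<exists>c. simple_path c \<and> pathfinish c = pathstart c \<and> path_image c = Img C"
    and "connected (Img C - core e)"
proof -
  have p: "graph_path G us es" "e \<in> edges G" "e \<notin> set es" "ends G e = {hd us, last us}"
    using assms by (auto simp: closes_def)
  have "(\<exists>c. simple_path c \<and> pathfinish c = pathstart c \<and> path_image c = Img C) \<and>
        connected (Img C - core e)"
  proof (cases "es = []")
    case True
    then have "hd us = last us"
      using p by (auto simp: graph_path_Nil)
    then have 1: "{pathstart (curve e), pathfinish (curve e)} = {pos (hd us)}"
      using curve_ends[OF p(2)] p(4) by simp
    then have "pathfinish (curve e) = pathstart (curve e)"
      by auto
    moreover have "img e - core e = {pos (hd us)}"
      using 1 p pathstart_in_path_image[of "curve e"] by (auto simp: core_eq)
    ultimately show ?thesis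
      using C True simple_curve[OF p(2)] by auto
  next
    case False
    \<comment> \<open>A path with an edge has two different ends, so \<open>e\<close> is not a loop
      and its curve is an arc. It is run from \<open>last us\<close> back to \<open>hd us\<close> to
      close the curve.\<close>
    have "length us \<ge> 2" "distinct us"
      using False p(1) by (cases es; simp add: graph_path_def)+
    then have "hd us \<noteq> last us"
      by (cases us) (auto split: if_splits)
    then obtain c where c: "arc c" "path_image c = img e" "pathstart c = pos (last us)" "pathfinish c = pos (hd us)"
      using oriented_curve[of e "last us" "hd us"] p by (metis insert_commute)
    obtain g where g: "arc g" "pathstart g = pos (hd us)" "pathfinish g = pos (last us)"
      "path_image g = Img (set es)"
      using graph_path_arc[OF p(1) False] by blast
    have es: "f \<in> edges G \<and> f \<noteq> e" if "f \<in> set es" for f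
      using p that by (auto simp: graph_path_def)
    have "path_image g \<inter> path_image c \<subseteq> {pathstart g, pathstart c}"
    proof -
      have "img e \<inter> img f \<subseteq> {pos (hd us), pos (last us)}" if "f \<in> set es" for f
        using es[OF that] img_Int_img_subset[of e f] p by auto
      then show ?thesis
        unfolding c g by (simp only: Int_UN_distrib2 UN_subset_iff Int_commute) blast
    qed
    then have "simple_path (g +++ c)"
      using c g by (intro simple_path_join_loop) auto
    moreover have "path_image (g +++ c) = Img C"
      using c g C by (auto simp: path_image_join)
    moreover have "Img C - core e = path_image g"
    proof
      have "pos ` ends G e \<subseteq> path_image g"
        using g p(4) pathstart_in_path_image[of g] pathfinish_in_path_image[of g] by auto
      then show "Img C - core e \<subseteq> path_image g"
        using C g by (auto simp: core_def)
      show "path_image g \<subseteq> Img C - core e"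
        using core_Int_img[OF p(2)] es C g by fastforce
    qed
    ultimately show ?thesis
      using c g connected_arc_image[OF g(1)] by (intro conjI exI[of _ "g +++ c"]) auto
  qed
  then show "\<exists>c. simple_path c \<and> pathfinish c = pathstart c \<and> path_image c = Img C"
    and "connected (Img C - core e)" by blast+
qed

section \<open>Faces at an edge and sides of a cycle\<close>

abbreviation "Faces \<equiv> faces G pos curve"
definition "faces_at e = {F \<in> Faces. e \<in> face_edges G curve F}"

lemma face_props:
  assumes "F \<in> Faces"
  shows "open F" "connected F" "F \<noteq> {}" "F \<inter> D = {}"
proof -
  have *: "F \<in> components (- D)"
    using assms by (simp add: faces_def)
  show "open F"
    using * compact_drawing by (metis open_components compact_imp_closed open_Compl)
  show "connected F" "F \<noteq> {}" "F \<inter> D = {}"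
    using in_components_connected[OF *] in_components_nonempty[OF *] in_components_subset[OF *]
    by auto
qed

text \<open>A face is open and misses the drawing, so on an edge its closure and its frontier agree.
  This brings incidence into the form used by \<open>ex1_component_along_arc\<close>.\<close>

lemma faces_at_iff:
  assumes "e \<in> edges G"
  shows "F \<in> faces_at e \<longleftrightarrow> F \<in> components (- D) \<and> core e \<subseteq> closure F"
proof -
  have "img e \<subseteq> frontier F \<longleftrightarrow> core e \<subseteq> closure F" if "F \<in> Faces"
  proof
    assume "img e \<subseteq> frontier F"
    then show "core e \<subseteq> closure F"
      by (auto simp: core_def frontier_def)
  next
    assume "core e \<subseteq> closure F"
    then have "img e \<subseteq> closure F"
      using img_subset_closure_core[OF assms] closure_minimal[of "core e" "closure F"] by auto
    then show "img e \<subseteq> frontier F"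
      using face_props[OF that] img_subset_drawing[OF assms]
      by (auto simp: frontier_def interior_open)
  qed
  then show ?thesis
    using assms by (auto simp: faces_at_def face_edges_def faces_def)
qed

text \<open>Signs are used so that the two faces at a cycle edge sum to zero. For a face, the
  default \<open>- 1\<close> means outside, by \<open>side_eq_iff\<close>.\<close>

definition side :: "'e set \<Rightarrow> complex set \<Rightarrow> int" where
  "side C F = (if F \<subseteq> inside (Img C) then 1 else - 1)"

lemma side_cases: "side C F = 1 \<or> side C F = - 1"
  by (simp add: side_def)

text \<open>A face is connected and misses the cycle, so it cannot meet both of the disjoint open
  sets inside and outside.\<close>

lemma side_eq_iff:
  assumes "C \<subseteq> edges G" "F \<in> Faces"
  shows "side C F = 1 \<longleftrightarrow> F \<subseteq> inside (Img C)" "side C F = - 1 \<longleftrightarrow> F \<subseteq> outside (Img C)"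
proof -
  have F: "connected F" "F \<noteq> {}" "F \<inter> Img C = {}"
    using face_props[OF assms(2)] assms(1) by (auto simp: drawing_def)
  have cl: "closed (Img C)"
    using assms compact_Img compact_imp_closed by blast
  have "F \<subseteq> inside (Img C) \<or> F \<subseteq> outside (Img C)"
  proof -
    have "F \<subseteq> inside (Img C) \<union> outside (Img C)"
      using F by auto
    then have "F \<inter> inside (Img C) = {} \<or> F \<inter> outside (Img C) = {}"
      using connectedD[OF F(1) open_inside[OF cl] open_outside[OF cl]] by auto
    then show ?thesis
      using \<open>F \<subseteq> inside (Img C) \<union> outside (Img C)\<close> by blast
  qed
  moreover have "\<not> (F \<subseteq> inside (Img C) \<and> F \<subseteq> outside (Img C))"
    using F inside_Int_outside[of "Img C"] by blast
  ultimately show "side C F = 1 \<longleftrightarrow> F \<subseteq> inside (Img C)" "side C F = - 1 \<longleftrightarrow> F \<subseteq> outside (Img C)"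
    by (auto simp: side_def)
qed

text \<open>By the Jordan curve theorem, inside and outside are both connected with frontier
  \<open>Img C\<close>. Each can serve as \<open>U\<close> in
  \<open>ex1_component_along_arc\<close>, which yields one face per side; there is no third
  side.\<close>

lemma faces_at_opposite_sides:
  assumes "closes G e us es" and C: "C = insert e (set es)"
  shows "\<exists>F1 F2. faces_at e = {F1, F2} \<and> side C F1 = 1 \<and> side C F2 = - 1"
proof -
  have sub: "C \<subseteq> edges G" "e \<in> C" "e \<in> edges G"
    using assms by (auto simp: closes_def graph_path_def)
  obtain c where c: "simple_path c" "pathfinish c = pathstart c" "path_image c = Img C"
    using closes_Jordan_curve(1)[OF assms] by blast
  note Jo = Jordan_inside_outside[OF c(1,2), unfolded c(3)]
  have *: "\<exists>!F. F \<in> components (- D) \<and> F \<subseteq> U \<and> core e \<subseteq> closure F"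
    if "U = inside (Img C) \<or> U = outside (Img C)" for U
  proof (rule ex1_component_along_arc)
    show "core e \<subseteq> Img C"
      using sub by (auto simp: core_def)
    show "Img C \<subseteq> D"
      using sub by (auto simp: drawing_def)
    show "closed (Img C)"
      using sub compact_Img compact_imp_closed by blast
    show "connected (Img C - core e)"
      using closes_Jordan_curve(2)[OF assms] .
    show "connected U" "U \<inter> Img C = {}" "frontier U = Img C"
      using Jo that by blast+
  qed (use sub compact_drawing compact_drawing_minus_core connected_core core_nonempty in auto)
  have "\<exists>!F. F \<in> faces_at e \<and> side C F = 1" "\<exists>!F. F \<in> faces_at e \<and> side C F = - 1"
    using *[of "inside (Img C)"] *[of "outside (Img C)"] side_eq_iff[OF sub(1)] faces_at_iff[OF sub(3)]
    unfolding faces_def by metis+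
  then obtain F1 F2 where F12: "F1 \<in> faces_at e" "side C F1 = 1" "F2 \<in> faces_at e" "side C F2 = - 1"
    and uniq: "\<And>F. F \<in> faces_at e \<Longrightarrow> side C F = 1 \<Longrightarrow> F = F1"
      "\<And>F. F \<in> faces_at e \<Longrightarrow> side C F = - 1 \<Longrightarrow> F = F2"
    by (elim ex1E conjE) blast
  then have "faces_at e = {F1, F2}"
    using side_cases[of C] uniq by blast
  then show ?thesis
    using F12 by blast
qed

text \<open>Without bridges, every edge lies on some cycle, not necessarily one of the two given.
  The opposite signs for that cycle show that the two faces differ.\<close>

lemma card_faces_at:
  assumes "bridgeless G" "e \<in> edges G"
  shows "card (faces_at e) = 2"
proof -
  obtain us es where "closes G e us es"
    using closes_if_not_bridge[OF fin assms(2)] assms(1) by (auto simp: bridgeless_def)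
  from faces_at_opposite_sides[OF this refl] obtain F1 F2 where
    F12: "faces_at e = {F1, F2}" "side (insert e (set es)) F1 = 1" "side (insert e (set es)) F2 = - 1"
    by blast
  then have "F1 \<noteq> F2"
    by auto
  then show ?thesis
    using F12 by simp
qed

lemma sum_side_faces_at:
  assumes "is_cycle G C" "e \<in> C"
  shows "sum (side C) (faces_at e) = 0"
proof -
  obtain us es where "closes G e us es" "C = insert e (set es)"
    using closes_if_in_cycle[OF assms] by blast
  from faces_at_opposite_sides[OF this] obtain F1 F2 where
    "faces_at e = {F1, F2}" "side C F1 = 1" "side C F2 = - 1" by blast
  then show ?thesis
    by (cases "F1 = F2") auto
qed

text \<open>A point \<open>p\<close> of the core is off the cycle, so it lies in the open inside or
  the open outside. As \<open>p\<close> is in the closure of every face at \<open>e\<close>, all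
  these faces meet that set.\<close>

lemma side_eq_if_not_in:
  assumes "C \<subseteq> edges G" "e \<in> edges G - C" "F \<in> faces_at e" "F' \<in> faces_at e"
  shows "side C F = side C F'"
proof -
  have e: "e \<in> edges G" using assms by simp
  have disj: "core e \<inter> Img C = {}"
    using core_Int_img[OF e] assms by blast
  have cl: "closed (Img C)"
    using assms compact_Img compact_imp_closed by blast
  have face: "K \<in> Faces" if "K \<in> faces_at e" for K
    using that by (simp add: faces_at_def)
  have meets: "K \<inter> U \<noteq> {}" if "K \<in> faces_at e" "open U" "core e \<inter> U \<noteq> {}" for K U
    using that faces_at_iff[OF e, of K] open_Int_closure_eq_empty[of U K] by blast
  obtain p where p: "p \<in> core e"
    using core_nonempty[OF e] by blast
  have op: "open (inside (Img C))" "open (outside (Img C))"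
    using cl open_inside open_outside by blast+
  have pio: "p \<in> inside (Img C) \<or> p \<in> outside (Img C)"
    using p disj inside_Un_outside[of "Img C"] by blast
  have "side C K = (if p \<in> inside (Img C) then 1 else - 1)" if K: "K \<in> faces_at e" for K
  proof (cases "p \<in> inside (Img C)")
    case True
    then have "\<not> K \<subseteq> outside (Img C)"
      using meets[OF K op(1)] p inside_Int_outside[of "Img C"] by blast
    then show ?thesis
      using True side_eq_iff[OF assms(1) face[OF K]] side_cases[of C K] by auto
  next
    case False
    then have "\<not> K \<subseteq> inside (Img C)"
      using meets[OF K op(2)] p pio inside_Int_outside[of "Img C"] by blast
    then show ?thesis
      using False side_eq_iff[OF assms(1) face[OF K]] side_cases[of C K] by auto
  qed
  then show ?thesis
    using assms by simp
qed

section \<open>Signed counting over the faces\<close>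

lemma side_unbounded:
  assumes "C \<subseteq> edges G" "\<not> bounded F"
  shows "side C F = - 1"
  using bounded_inside[of "Img C"] compact_Img[OF assms(1)] assms(2)
  by (auto simp: side_def compact_imp_bounded dest: bounded_subset)

lemma is_cycle_subset: "is_cycle G C \<Longrightarrow> C \<subseteq> edges G"
  by (auto simp: is_cycle_def)

text \<open>If \<open>e\<close> lies on just one of the two cycles, the product of the side functions changes sign
  across \<open>e\<close>; otherwise the factor on the right vanishes.\<close>

lemma sum_sides_product:
  assumes "bridgeless G" "is_cycle G C1" "is_cycle G C2" "e \<in> edges G"
  shows "(\<Sum>F\<in>faces_at e. side C1 F * side C2 F * (of_bool (e \<in> C1) - of_bool (e \<in> C2))) = 0"
proof -
  have E: "C1 \<subseteq> edges G" "C2 \<subseteq> edges G"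
    using assms is_cycle_subset by auto
  have *: "(\<Sum>F\<in>faces_at e. side A F * side B F) = 0"
    if "is_cycle G A" "B \<subseteq> edges G" "e \<in> A" "e \<notin> B" for A B
  proof -
    obtain F0 where F0: "F0 \<in> faces_at e"
      using card_faces_at[OF assms(1,4)] by fastforce
    \<comment> \<open>Off \<open>B\<close> the factor \<open>side B\<close> is constant on the faces
      at \<open>e\<close> and can be pulled out; the remaining sum vanishes because \<open>e\<close>
      is on \<open>A\<close>.\<close>
    have "(\<Sum>F\<in>faces_at e. side A F * side B F) = (\<Sum>F\<in>faces_at e. side A F * side B F0)"
      using side_eq_if_not_in[OF that(2) _ _ F0] that assms(4) by (intro sum.cong) auto
    also have "\<dots> = 0"
      using sum_side_faces_at[OF that(1,3)] by (simp flip: sum_distrib_right)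
    finally show ?thesis .
  qed
  show ?thesis
    using *[of C1 C2] *[of C2 C1] assms(2,3) E
    by (cases "e \<in> C1"; cases "e \<in> C2") (auto simp: mult.commute sum_negf simp flip: sum_distrib_right)
qed

lemma unbounded_face_unique:
  assumes "F \<in> Faces" "F' \<in> Faces" "\<not> bounded F" "\<not> bounded F'"
  shows "F = F'"
  using cobounded_unique_unbounded_components[of "- D" F' F] compact_drawing assms
  by (simp add: faces_def compact_imp_bounded)

lemma card_eq_of_signature_eq:
  assumes br: "bridgeless G" and cyc: "is_cycle G C1" "is_cycle G C2"
    and sig: "signature G pos curve C1 = signature G pos curve C2"
  shows "card C1 = card C2"
proof -
  \<comment> \<open>Only faces with an edge are collected: they are finitely many, two per edge, and
    all other faces have count zero.\<close>
  define \<Phi> where "\<Phi> = (\<Union>e\<in>edges G. faces_at e)"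
  define t where "t F = side C1 F * side C2 F" for F
  define m where "m C F = int (card (face_edges G curve F \<inter> C))" for C F
  have E: "C1 \<subseteq> edges G" "C2 \<subseteq> edges G"
    using cyc is_cycle_subset by auto
  have "finite (faces_at e)" if "e \<in> edges G" for e
    using card_faces_at[OF br that] by (intro card_ge_0_finite) simp
  then have fin\<Phi>: "finite \<Phi>"
    using finite_edges by (simp add: \<Phi>_def)
  have \<Phi>: "F \<in> Faces" if "F \<in> \<Phi>" for F
    using that by (auto simp: \<Phi>_def faces_at_def)
  \<comment> \<open>Double counting of incident pairs of a face and an edge, with arbitrary
    weights.\<close>
  have swap: "(\<Sum>F\<in>\<Phi>. \<Sum>e\<in>face_edges G curve F. w F e) = (\<Sum>e\<in>edges G. \<Sum>F\<in>faces_at e. w F e)"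
    for w :: "complex set \<Rightarrow> 'e \<Rightarrow> int"
  proof -
    have "face_edges G curve F = {e. e \<in> edges G \<and> e \<in> face_edges G curve F}" for F
      by (auto simp: face_edges_def)
    moreover have "faces_at e = {F \<in> \<Phi>. e \<in> face_edges G curve F}" if "e \<in> edges G" for e
      using that by (auto simp: \<Phi>_def faces_at_def)
    ultimately show ?thesis
      using sum.swap_restrict[OF fin\<Phi> finite_edges, of w "\<lambda>F e. e \<in> face_edges G curve F"]
      by (simp cong: sum.cong)
  qed
  have finfe: "finite (face_edges G curve F)" for F
    using finite_edges by (auto simp: face_edges_def)
  have m_sum: "m C F = (\<Sum>e\<in>face_edges G curve F. of_bool (e \<in> C))" for C F
    using finfe by (simp add: m_def of_bool_def sum.If_cases Int_def)
  have "(\<Sum>F\<in>\<Phi>. t F * (m C1 F - m C2 F)) = 0"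
  proof -
    have "(\<Sum>F\<in>\<Phi>. t F * (m C1 F - m C2 F)) =
          (\<Sum>F\<in>\<Phi>. \<Sum>e\<in>face_edges G curve F. t F * (of_bool (e \<in> C1) - of_bool (e \<in> C2)))"
      by (simp add: m_sum sum_subtractf flip: sum_distrib_left)
    also have "\<dots> = 0"
      unfolding swap t_def using sum_sides_product[OF br cyc] by (intro sum.neutral) auto
    finally show ?thesis .
  qed
  moreover have bdd: "m C1 F = m C2 F" if "F \<in> \<Phi>" "bounded F" for F
    using fun_cong[OF sig, of F] \<Phi>[OF that(1)] that(2)
    by (simp add: m_def signature_def finite_faces_def)
  moreover have "m C1 F = m C2 F" if F: "F \<in> \<Phi>" "\<not> bounded F" for F
  proof -
    have "bounded F'" if "F' \<in> \<Phi> - {F}" for F'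
      using unbounded_face_unique[OF \<Phi> \<Phi>, of F' F] that F by blast
    then have "(\<Sum>F'\<in>\<Phi> - {F}. t F' * (m C1 F' - m C2 F')) = 0"
      using bdd by (intro sum.neutral) auto
    \<comment> \<open>\<open>calculation(1)\<close> is the vanishing total; with all bounded faces
      contributing zero, only the term of \<open>F\<close> is left.\<close>
    then have "t F * (m C1 F - m C2 F) = 0"
      using calculation(1) sum.remove[OF fin\<Phi> F(1), of "\<lambda>F. t F * (m C1 F - m C2 F)"] by simp
    moreover have "t F = 1"
      using side_unbounded[OF E(1) F(2)] side_unbounded[OF E(2) F(2)] by (simp add: t_def)
    ultimately show ?thesis by simp
  qed
  ultimately have "(\<Sum>F\<in>\<Phi>. m C1 F) = (\<Sum>F\<in>\<Phi>. m C2 F)"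
    by (intro sum.cong) auto
  moreover have "(\<Sum>F\<in>\<Phi>. m C F) = 2 * int (card C)" if "C \<subseteq> edges G" for C
  proof -
    have "(\<Sum>F\<in>\<Phi>. m C F) = (\<Sum>e\<in>edges G. 2 * of_bool (e \<in> C))"
      unfolding m_sum swap using card_faces_at[OF br] by (intro sum.cong) auto
    also have "\<dots> = 2 * int (card C)"
      using finite_edges that by (simp add: of_bool_def sum.If_cases Int_absorb1 flip: sum_distrib_left)
    finally show ?thesis .
  qed
  ultimately show ?thesis
    using E by simp
qed

end

theorem theorem1:
  fixes G :: "('v, 'e) ugraph"
    and pos :: "'v \<Rightarrow> complex"
    and curve :: "'e \<Rightarrow> real \<Rightarrow> complex"
    and C1 C2 :: "'e set"
  assumes "finite_graph G"
    and "connected_graph G"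
    and "bridgeless G"
    and "plane_embedding G pos curve"
    and "is_cycle G C1"
    and "is_cycle G C2"
    and "signature G pos curve C1 = signature G pos curve C2"
  shows "card C1 = card C2"
proof -
  interpret plane_graph G pos curve
    using assms by unfold_locales
  show ?thesis
    using assms by (intro card_eq_of_signature_eq)
qed

end
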